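(* Let $n$ be a positive integer such that $n = 11q_1+2$ with $q_1\geq 5$, or $n=11q_2+5$ with $q_2\geq 3$, or $n = 11q_3+8$ with $q_3 \geq 1$. Then $\gamma^{ID}(C_n(1,3)) \geq \lceil 4n/11\rceil + 1$.
   Context: For a positive integer $n$, the circulant graph $C_n(1,3)$ has vertex set $\mathbb{Z}_n$, and $u$ is adjacent to $u\pm1$ and $u\pm 3$ (modulo $n$); $N[u]=\{u,u\pm1,u\pm3\}$. For a code (nonempty subset) $C\subseteq\mathbb{Z}_n$, $I(C;u)=N[u]\cap C$. $C$ is identifying if $I(C;u)\neq\emptyset$ for all $u$ and $I(C;u)\ne I(C;v)$ for all distinct $u,v$. $\gamma^{ID}(G)$ is the minimum cardinality of an identifying code in $G$. *)

theory Defs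
  imports Complex_Main "HOL-Number_Theory.Cong"
begin

text \<open>A graph is given by a vertex set \<open>V\<close> and an adjacency relation \<open>adj\<close>.\<close>

definition closed_nbhd :: "'a set \<Rightarrow> ('a \<Rightarrow> 'a \<Rightarrow> bool) \<Rightarrow> 'a \<Rightarrow> 'a set" where
  "closed_nbhd V adj u = {v \<in> V. v = u \<or> adj u v}"

definition is_code :: "'a set \<Rightarrow> 'a set \<Rightarrow> bool" where
  "is_code V C \<longleftrightarrow> C \<subseteq> V \<and> C \<noteq> {}"

definition I_set :: "'a set \<Rightarrow> ('a \<Rightarrow> 'a \<Rightarrow> bool) \<Rightarrow> 'a set \<Rightarrow> 'a \<Rightarrow> 'a set" where
  "I_set V adj C u = closed_nbhd V adj u \<inter> C"

definition identifying_code :: "'a set \<Rightarrow> ('a \<Rightarrow> 'a \<Rightarrow> bool) \<Rightarrow> 'a set \<Rightarrow> bool" where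
  "identifying_code V adj C \<longleftrightarrow> is_code V C
     \<and> (\<forall>u\<in>V. I_set V adj C u \<noteq> {})
     \<and> (\<forall>u\<in>V. \<forall>v\<in>V. u \<noteq> v \<longrightarrow> I_set V adj C u \<noteq> I_set V adj C v)"

text \<open>For a finite graph. The value is unspecified if the graph has no identifying code,
  that is, if two distinct vertices have the same closed neighbourhood.\<close>

definition gamma_ID :: "'a set \<Rightarrow> ('a \<Rightarrow> 'a \<Rightarrow> bool) \<Rightarrow> nat" where
  "gamma_ID V adj = (LEAST k. \<exists>C. identifying_code V adj C \<and> card C = k)"

text \<open>\<open>\<int>\<^sub>n\<close> is represented by the residues \<open>0, \<dots>, n - 1\<close>.\<close>

definition circ_verts :: "nat \<Rightarrow> int set" where
  "circ_verts n = {0..<int n}"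

definition circ_adj :: "nat \<Rightarrow> int \<Rightarrow> int \<Rightarrow> bool" where
  "circ_adj n u v \<longleftrightarrow> (\<exists>d\<in>{1, -1, 3, -3}. [v = u + d] (mod int n))"

end

theory Submission imports Defs begin

text \<open>
  Read a code \<open>C\<close> as an \<open>n\<close>-periodic bit sequence \<open>x\<close>. Domination and separation of vertices at
  distance at most 6 say that \<open>x\<close> has a one in every translate of six finite patterns. Put
  \<open>w = 11 \<bar>C\<bar> - 4 n\<close>. Since \<open>11 \<lceil>4 n / 11\<rceil> - 4 n\<close> is 3, 2 and 1 in the three residue
  classes, the claim is that \<open>w\<close> exceeds these values.

  The only sequence of density exactly \<open>4/11\<close> that occurs is the one with period \<open>01100000110\<close>.
  Counting the positions \<open>i\<close> at which the last ten bits are not a factor of it (off the cycle) and the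
  positions where \<open>x\<close> has just left it, a potential function on finite histories of \<open>x\<close> gives
  \<open>18 w \<ge> #off + 54 #leave\<close>. If \<open>x\<close> leaves the cycle at least once, then \<open>18 w \<ge> 55\<close>, so \<open>w \<ge> 4\<close>;
  if it never meets the cycle, then \<open>18 w \<ge> n\<close>; and if it stays on the cycle, every 11 consecutive
  bits contain 4 ones, so \<open>11 \<bar>C\<bar> = 4 n\<close>, which is impossible as \<open>n\<close> is not a multiple of 11. The
  factor 18 is below \<open>19 = 57/3 = 38/2 = 19/1\<close>, where 57, 38 and 19 are the smallest \<open>n\<close> allowed in
  the three classes, so \<open>18 w \<ge> n\<close> makes \<open>w\<close> exceed 3, 2 and 1, respectively.
\<close>

section \<open>Context trees and the potential\<close>

datatype context_tree = Leaf int | Node context_tree context_tree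

fun lookup :: "context_tree \<Rightarrow> (nat \<Rightarrow> bool) \<Rightarrow> int" where
  "lookup (Leaf a) h = a"
| "lookup (Node l r) h = lookup (if h 0 then r else l) (h \<circ> Suc)"

text \<open>Finite-word version of \<open>lookup\<close>: \<open>Some\<close> means that the word
  already reaches a leaf, so the value holds for every history extending it.\<close>

fun probe :: "context_tree \<Rightarrow> bool list \<Rightarrow> int option" where
  "probe (Leaf a) w = Some a"
| "probe (Node l r) [] = None"
| "probe (Node l r) (b # w) = probe (if b then r else l) w"

lemma map_upt_split: "0 < m \<Longrightarrow> map h [0..<m] = h 0 # map (h \<circ> Suc) [0..<m - 1]"
  by (cases m) (simp_all add: map_upt_Suc comp_def del: upt_Suc)

lemma probe_lookup: "probe t (map h [0..<m]) = Some a \<Longrightarrow> lookup t h = a"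
proof (induction t arbitrary: h m)
  case (Node l r)
  then have m: "0 < m" by (cases m) auto
  show ?case
    using Node unfolding map_upt_split[OF m, of h] by (auto split: if_splits)
qed simp

text \<open>
  Branches are read from the newest bit to older ones, the left branch being a zero. The values are
  shortest-path distances in the graph of admissible words, edges being weighted by \<open>weight\<close> below;
  words have been merged where the path distances allow it. Some of the leaves \<open>0\<close> belong to words
  that no admissible sequence contains, and are junk.
\<close>
definition potential :: context_tree where
  "potential =
    Node (Node (Node (Node (Node (Node (Leaf 438)
                                     (Node (Leaf 0)
                                           (Node (Node (Leaf 371) (Leaf 366)) (Leaf 365))))
                               (Node (Node (Leaf 429) (Leaf 418))
                                     (Node (Node (Node (Leaf 0)
                                                       (Node (Leaf 366) (Leaf 299)))
                                                 (Leaf 293))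
                                           (Node (Node (Node (Node (Leaf 0)
                                                                   (Node (Leaf 294)
                                                                         (Leaf 292)))
                                                             (Leaf 292))
                                                       (Leaf 292))
                                                 (Leaf 292)))))
                         (Node (Node (Node (Leaf 376) (Node (Leaf 377) (Leaf 356)))
                                     (Leaf 345))
                               (Node (Node (Node (Leaf 0) (Node (Leaf 293) (Leaf 227)))
                                           (Leaf 220))
                                     (Node (Node (Node (Node (Leaf 282)
                                                             (Node (Leaf 221) (Leaf 219)))
                                                       (Leaf 219))
                                                 (Leaf 219))
                                           (Leaf 219)))))
                   (Node (Node (Node (Node (Leaf 315) (Leaf 303))
                                     (Node (Node (Node (Leaf 324) (Leaf 304)) (Leaf 293))
                                           (Leaf 283)))
                               (Leaf 272))
                         (Node (Node (Node (Node (Node (Leaf 263) (Leaf 262)) (Leaf 241))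
                                           (Node (Leaf 220) (Node (Leaf 155) (Leaf 146))))
                                     (Leaf 147))
                               (Node (Node (Node (Node (Leaf 209)
                                                       (Node (Leaf 148) (Leaf 146)))
                                                 (Leaf 146))
                                           (Leaf 146))
                                     (Leaf 146)))))
             (Node (Node (Node (Node (Node (Leaf 0) (Node (Leaf 366) (Leaf 242)))
                                     (Node (Leaf 0) (Node (Leaf 241) (Leaf 230))))
                               (Node (Node (Node (Leaf 251) (Leaf 231)) (Leaf 220))
                                     (Leaf 210)))
                         (Leaf 199))
                   (Node (Node (Node (Node (Node (Leaf 191) (Leaf 189)) (Leaf 168))
                                     (Node (Leaf 147)
                                           (Node (Node (Leaf 83) (Leaf 73)) (Leaf 73))))
                               (Leaf 74))
                         (Node (Node (Node (Node (Leaf 136) (Node (Leaf 75) (Leaf 73)))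
                                           (Leaf 73))
                                     (Leaf 73))
                               (Leaf 73)))))
       (Node (Node (Node (Node (Node (Node (Leaf 313)
                                           (Node (Leaf 0) (Node (Leaf 245) (Leaf 240))))
                                     (Node (Node (Leaf 304) (Leaf 293))
                                           (Node (Leaf 241) (Leaf 169))))
                               (Node (Node (Leaf 252) (Leaf 220))
                                     (Node (Leaf 168) (Leaf 157))))
                         (Node (Node (Node (Node (Leaf 190) (Leaf 178))
                                           (Node (Leaf 199) (Leaf 158)))
                                     (Leaf 147))
                               (Node (Node (Node (Node (Leaf 137) (Leaf 116)) (Leaf 95))
                                           (Leaf 22))
                                     (Leaf 84))))
                   (Node (Node (Node (Node (Node (Leaf 0) (Node (Leaf 241) (Leaf 117)))
                                           (Leaf 116))
                                     (Leaf 126))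
                               (Leaf 74))
                         (Leaf 120)))
             (Node (Node (Node (Node (Node (Node (Leaf 188) (Leaf 119))
                                           (Node (Leaf 179) (Leaf 116)))
                                     (Node (Node (Leaf 127) (Leaf 95)) (Leaf 43)))
                               (Node (Leaf 74)
                                     (Node (Node (Node (Leaf 11) (Leaf 0)) (Leaf 0))
                                           (Leaf 0))))
                         (Node (Node (Node (Node (Leaf 116) (Leaf 0)) (Leaf 1)) (Leaf 0))
                               (Leaf 0)))
                   (Node (Node (Node (Node (Leaf 63) (Node (Leaf 2) (Leaf 0))) (Leaf 0))
                               (Leaf 0))
                         (Leaf 0))))"

section \<open>Forbidden zero patterns and the finite search\<close>

text \<open>
  The closed neighbourhood \<open>{-3, -1, 0, 1, 3}\<close> shifted to start at 0, and its symmetric differences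
  with its translates by 1, 2, 3, 4 and 6. Translation by 5 makes the two disjoint and adds nothing.
\<close>
definition patterns :: "nat list list" where
  "patterns = [[0,2,3,4,6], [0,1,2,5,6,7], [0,3,5,8], [0,2,4,5,7,9], [0,2,3,7,8,10],
     [0,2,3,4,8,9,10,12]]"

text \<open>
  Words list the newest bit first. Only the alignment at the oldest bit is tested: the search below
  has met the other ones at shorter words.
\<close>
definition avoids :: "bool list \<Rightarrow> bool" where
  "avoids w \<longleftrightarrow> (\<exists>p\<in>set patterns. last p < length w \<and> (\<forall>j\<in>set p. \<not> w ! (length w - Suc j)))"

text \<open>The eleven-bit period is a palindrome, so listing the newest bit first gives the same
  words.\<close>

definition cycle_words :: "bool list list" where
  "cycle_words = map (\<lambda>k. take 10 (rotate k
     [False,True,True,False,False,False,False,False,True,True,False])) [0..<11]"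

definition leaving_words :: "bool list list" where
  "leaving_words = filter (\<lambda>w. take 10 w \<notin> set cycle_words)
     (map (Cons False) cycle_words @ map (Cons True) cycle_words)"

text \<open>
  A lower bound for \<open>weight\<close> below that is valid for all extensions of \<open>w\<close> into the past; the
  constants are \<open>126 = 18 (11 - 4)\<close> and \<open>-72 = 18 (0 - 4)\<close>.
\<close>
definition weight_bound :: "bool list \<Rightarrow> int" where
  "weight_bound w = (if hd w then 126 else - 72)
     - (if 10 \<le> length w \<and> take 10 w \<in> set cycle_words then 0 else 1)
     - (if \<exists>l\<in>set leaving_words. take (length w) l = take 11 w then 54 else 0)"

definition decided :: "bool list \<Rightarrow> bool" where
  "decided w \<longleftrightarrow> w \<noteq> [] \<and>
     (case probe potential (tl w) of None \<Rightarrow> False | Some a \<Rightarrow>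
      (case probe potential w of None \<Rightarrow> False | Some b \<Rightarrow> a \<le> weight_bound w + b))"

text \<open>The nested conditionals stop \<open>code_simp\<close> from evaluating both sides of a disjunction.\<close>
fun search :: "nat \<Rightarrow> bool list \<Rightarrow> bool" where
  "search 0 w \<longleftrightarrow> decided w"
| "search (Suc k) w \<longleftrightarrow> (if decided w then True else if avoids w then True
     else if search k (w @ [False]) then search k (w @ [True]) else False)"

text \<open>The finite computation behind the bound: within 14 bits, every branch either settles the
  potential inequality or fills a pattern with zeros.\<close>

lemma search_complete: "search 14 []"
  by code_simp

lemma search_sound:
  "search k (map h [0..<m]) \<Longrightarrow> \<exists>m. decided (map h [0..<m]) \<or> avoids (map h [0..<m])"
proof (induction k arbitrary: m)
  case (Suc k)
  have snoc: "map h [0..<Suc m] = map h [0..<m] @ [h m]" by simp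
  show ?case
  proof (cases "decided (map h [0..<m]) \<or> avoids (map h [0..<m])")
    case False
    with Suc.prems have "search k (map h [0..<m] @ [h m])"
      by (cases "h m") (auto split: if_splits)
    then show ?thesis
      by (intro Suc.IH[of "Suc m"]) (simp only: snoc)
  qed blast
qed auto

section \<open>The potential inequality for bit sequences\<close>

abbreviation past :: "(int \<Rightarrow> bool) \<Rightarrow> int \<Rightarrow> nat \<Rightarrow> bool" where
  "past x i \<equiv> \<lambda>j. x (i - int j)"

definition on_cycle :: "(int \<Rightarrow> bool) \<Rightarrow> int \<Rightarrow> bool" where
  "on_cycle x i \<longleftrightarrow> map (past x i) [0..<10] \<in> set cycle_words"

definition weight :: "(int \<Rightarrow> bool) \<Rightarrow> int \<Rightarrow> int" where
  "weight x i = (if x i then 126 else - 72) - (if on_cycle x i then 0 else 1)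
     - (if on_cycle x (i - 1) \<and> \<not> on_cycle x i then 54 else 0)"

definition hits_patterns :: "(int \<Rightarrow> bool) \<Rightarrow> bool" where
  "hits_patterns x \<longleftrightarrow> (\<forall>p\<in>set patterns. \<forall>i. \<exists>j\<in>set p. x (i + int j))"

lemma past_Suc: "past x i \<circ> Suc = past x (i - 1)"
  by (auto simp: fun_eq_iff algebra_simps)

lemma past_split: "0 < m \<Longrightarrow> map (past x i) [0..<m] = x i # map (past x (i - 1)) [0..<m - 1]"
  using map_upt_split[of m "past x i"] by (simp add: past_Suc)

lemma patterns_sorted: "p \<in> set patterns \<Longrightarrow> j \<in> set p \<Longrightarrow> j \<le> last p"
  by (auto simp: patterns_def)

lemma not_avoids:
  assumes "hits_patterns x"
  shows "\<not> avoids (map (past x i) [0..<m])"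
proof
  assume "avoids (map (past x i) [0..<m])"
  then obtain p where p: "p \<in> set patterns" "last p < m"
    and av: "\<forall>j\<in>set p. \<not> map (past x i) [0..<m] ! (m - Suc j)"
    by (auto simp: avoids_def)
  \<comment> \<open>The pattern is placed at the position of the oldest bit of the word.\<close>
  obtain j where j: "j \<in> set p" "x (i - int m + 1 + int j)"
    using assms p(1) unfolding hits_patterns_def by blast
  have "j < m" using patterns_sorted[OF p(1) j(1)] p(2) by simp
  then have "map (past x i) [0..<m] ! (m - Suc j) = x (i - int m + 1 + int j)"
    by (simp add: of_nat_diff algebra_simps)
  with av j show False by blast
qed

lemma leaving_word:
  assumes "on_cycle x (i - 1)" "\<not> on_cycle x i"
  shows "map (past x i) [0..<11] \<in> set leaving_words"
proof -
  have eq: "map (past x i) [0..<11] = x i # map (past x (i - 1)) [0..<10]"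
    using past_split[of 11 x i] by simp
  have "take 10 (map (past x i) [0..<11]) = map (past x i) [0..<10]"
    by (simp add: take_map)
  with assms eq show ?thesis
    by (cases "x i") (auto simp: leaving_words_def on_cycle_def)
qed

lemma take_upt_min: "take k [0..<m] = [0..<min k m]"
  by (cases "k \<le> m") (simp_all add: min_def)

text \<open>\<open>weight_bound\<close> makes each deduction unless the known bits exclude it, so
  older bits can only cancel deductions.\<close>

lemma weight_bound_le: "0 < m \<Longrightarrow> weight_bound (map (past x i) [0..<m]) \<le> weight x i"
proof -
  assume m: "0 < m"
  let ?w = "map (past x i) [0..<m]"
  have hd: "hd ?w = x i" using past_split[OF m] by simp
  have on: "on_cycle x i" if "10 \<le> length ?w" "take 10 ?w \<in> set cycle_words"
    using that by (simp add: take_map on_cycle_def min_def)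
  \<comment> \<open>Both sides are the newest \<open>min m 11\<close> bits, whether the word is
    shorter or longer than 11.\<close>
  have lv: "\<exists>l\<in>set leaving_words. take (length ?w) l = take 11 ?w"
    if "on_cycle x (i - 1)" "\<not> on_cycle x i"
    by (intro bexI[OF _ leaving_word[OF that]]) (simp add: take_map take_upt_min min.commute)
  show ?thesis
    unfolding weight_bound_def weight_def hd using on lv by (auto simp del: set_map)
qed

text \<open>The search stops at a prefix of the history of \<open>x\<close>. That prefix cannot
  avoid a pattern, so it is decided, and both potentials are read off it.\<close>

lemma potential_step:
  assumes "hits_patterns x"
  shows "lookup potential (past x (i - 1)) \<le> weight x i + lookup potential (past x i)"
proof -
  have "search 14 (map (past x i) [0..<0])"
    using search_complete by simp
  from search_sound[OF this] obtain m where "decided (map (past x i) [0..<m])"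
    using not_avoids[OF assms] by blast
  then obtain a b where m: "0 < m"
    and a: "probe potential (tl (map (past x i) [0..<m])) = Some a"
    and b: "probe potential (map (past x i) [0..<m]) = Some b"
    and le: "a \<le> weight_bound (map (past x i) [0..<m]) + b"
    by (auto simp: decided_def split: option.splits)
  have "lookup potential (past x (i - 1)) = a"
    using a by (intro probe_lookup[where m = "m - 1"]) (simp add: past_split[OF m])
  moreover have "lookup potential (past x i) = b"
    using b by (rule probe_lookup)
  ultimately show ?thesis
    using le weight_bound_le[OF m, of x i] by linarith
qed

section \<open>Averaging over a period\<close>

lemma sum_shift:
  fixes f :: "int \<Rightarrow> 'a::ab_group_add"
  assumes "\<And>i. f (i + int n) = f i"
  shows "(\<Sum>k<n. f (int k - int j)) = (\<Sum>k<n. f (int k))"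
proof (induction j)
  case (Suc j)
  let ?g = "\<lambda>k. f (int k - int (Suc j))"
  \<comment> \<open>A shift by one changes the sum by a difference of end terms, which periodicity
    cancels.\<close>
  have "(\<Sum>k<n. ?g k - ?g (Suc k)) = ?g 0 - ?g n"
    by (rule sum_lessThan_telescope')
  also have "\<dots> = 0"
    using assms[of "- int (Suc j)"] by (simp add: algebra_simps)
  finally have "(\<Sum>k<n. ?g k) = (\<Sum>k<n. ?g (Suc k))"
    by (simp add: sum_subtractf)
  also have "\<dots> = (\<Sum>k<n. f (int k - int j))"
    by simp
  finally show ?case using Suc by simp
qed simp

lemma periodic_shift:
  assumes per: "\<And>i. x (i + int n) = (x i :: bool)"
  shows "x (i + int n - j) = x (i - j)"
  using per[of "i - j"] by (simp add: algebra_simps)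

lemma on_cycle_periodic:
  assumes "\<And>i. x (i + int n) = x i"
  shows "on_cycle x (i + int n) = on_cycle x i"
  by (simp only: on_cycle_def periodic_shift[of x n, OF assms])

text \<open>Summing \<open>potential_step\<close> over a period cancels the potentials.\<close>

lemma sum_weight_nonneg:
  assumes "hits_patterns x" and per: "\<And>i. x (i + int n) = x i"
  shows "0 \<le> (\<Sum>k<n. weight x (int k))"
proof -
  let ?V = "\<lambda>i. lookup potential (past x i)"
  have "(\<Sum>k<n. ?V (int k - int 1)) = (\<Sum>k<n. ?V (int k))"
    by (rule sum_shift) (simp only: periodic_shift[of x n, OF per])
  moreover have "(\<Sum>k<n. ?V (int k - int 1)) \<le> (\<Sum>k<n. weight x (int k) + ?V (int k))"
    by (intro sum_mono) (use potential_step[OF assms(1)] in simp)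
  ultimately show ?thesis by (simp add: sum.distrib)
qed

lemma periodic_witness:
  assumes "\<And>i. P (i + int n) = P i" and "0 < n" and "P i"
  obtains k where "k < n" "P (int k)"
proof
  have *: "P (i + int n * q) = P i" for i q
  proof (induction q rule: int_induct[where k = 0])
    case (step1 q)
    then show ?case using assms(1)[of "i + int n * q"] by (simp add: algebra_simps)
  next
    case (step2 q)
    then show ?case using assms(1)[of "i + int n * (q - 1)"] by (simp add: algebra_simps)
  qed simp
  have "P (i mod int n)"
    using *[of "i mod int n" "i div int n"] assms(3) by simp
  then show "P (int (nat (i mod int n)))" using assms(2) by simp
  show "nat (i mod int n) < n" using assms(2) by (simp add: nat_less_iff)
qed

text \<open>Nine consecutive bits fix the phase on the cycle, so \<open>b\<close> completes
  \<open>z\<close> to a full period.\<close>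

lemma cycle_word_weight:
  "\<forall>z\<in>set cycle_words. \<forall>b\<in>{False, True}. take 10 (b # z) \<in> set cycle_words \<longrightarrow>
     length (filter (\<lambda>b. b) (b # z)) = 4"
  by code_simp

lemma on_cycle_window_sum:
  assumes "on_cycle x (i - 1)" "on_cycle x i"
  shows "(\<Sum>j<11. of_bool (x (i - int j))) = (4 :: int)"
proof -
  let ?w = "map (past x i) [0..<11]"
  have eq: "?w = x i # map (past x (i - 1)) [0..<10]"
    using past_split[of 11 x i] by simp
  have "take 10 ?w = map (past x i) [0..<10]"
    by (simp add: take_map)
  then have "take 10 (x i # map (past x (i - 1)) [0..<10]) \<in> set cycle_words"
    using assms(2) unfolding eq on_cycle_def by simp
  then have "length (filter (\<lambda>b. b) ?w) = 4"
    unfolding eq using cycle_word_weight assms(1) unfolding on_cycle_def by blast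
  moreover have "(\<Sum>j<11. of_bool (x (i - int j))) = int (length (filter (\<lambda>b. b) ?w))"
    by (simp add: upt_rec numeral_eq_Suc)
  ultimately show ?thesis by simp
qed

lemma periodic_density:
  assumes hits: "hits_patterns x" and per: "\<And>i. x (i + int n) = x i"
    and n: "0 < n" "\<not> 11 dvd n" and c: "c = (\<Sum>k<n. of_bool (x (int k)))"
  shows "4 \<le> 11 * c - 4 * int n \<or> int n \<le> 18 * (11 * c - 4 * int n)"
proof -
  define off where "off = (\<Sum>k<n. if on_cycle x (int k) then 0 else 1 :: int)"
  define leave where "leave i \<longleftrightarrow> on_cycle x (i - 1) \<and> \<not> on_cycle x i" for i
  define lv where "lv = (\<Sum>k<n. if leave (int k) then 54 else 0 :: int)"
  have onper: "on_cycle x (i + int n) = on_cycle x i" for i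
    by (rule on_cycle_periodic[of x n, OF per])
  have lper: "leave (i + int n) = leave i" for i
    using onper[of i] onper[of "i - 1"] unfolding leave_def by (simp add: algebra_simps)
  \<comment> \<open>Here 198 = 126 + 72 = 18 * 11 and 72 = 18 * 4.\<close>
  have "(\<Sum>k<n. weight x (int k)) = (\<Sum>k<n. 198 * of_bool (x (int k)) - 72) - off - lv"
    unfolding off_def lv_def sum_subtractf[symmetric]
    by (intro sum.cong) (auto simp: weight_def leave_def)
  also have "(\<Sum>k<n. 198 * of_bool (x (int k)) - 72) = 198 * c - 72 * int n"
    unfolding c by (simp add: sum_subtractf sum_distrib_left)
  finally have main: "off + lv \<le> 18 * (11 * c - 4 * int n)"
    using sum_weight_nonneg[OF hits per] by simp
  have lv0: "0 \<le> lv"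
    unfolding lv_def by (auto intro!: sum_nonneg)
  consider (leaves) i where "leave i" | (never) "\<And>i. \<not> on_cycle x i"
    | (always) i where "on_cycle x i" "\<And>i. \<not> leave i" by blast
  then show ?thesis
  proof cases
    case leaves
    obtain k where k: "k < n" "leave (int k)"
      using periodic_witness[of leave, OF lper n(1) leaves] .
    have "54 \<le> lv"
      using member_le_sum[of k "{..<n}" "\<lambda>k. if leave (int k) then 54 else 0 :: int"] k
      unfolding lv_def by simp
    \<comment> \<open>As 54 = 18 * 3 alone gives only 3, the unit from the leaving position, itself
      off the cycle, is what yields 4.\<close>
    moreover have "1 \<le> off"
      using member_le_sum[of k "{..<n}" "\<lambda>k. if on_cycle x (int k) then 0 else 1 :: int"] k
      unfolding off_def leave_def by simp
    ultimately show ?thesis using main by simp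
  next
    case never
    then have "off = int n" unfolding off_def by simp
    with main lv0 show ?thesis by simp
  next
    case always
    obtain k where k: "on_cycle x (int k)"
      using periodic_witness[of "on_cycle x", OF onper n(1) always(1)] by blast
    have on: "on_cycle x (int k + int m)" for m
    proof (induction m)
      case (Suc m)
      then show ?case using always(2)[of "int k + int (Suc m)"] unfolding leave_def by simp
    qed (simp add: k)
    \<comment> \<open>Being on the cycle propagates only forward, so an off-cycle position is first
      moved past \<open>k\<close> by a multiple of the period.\<close>
    have all: "on_cycle x i" for i
    proof (rule ccontr)
      assume "\<not> on_cycle x i"
      have "\<not> on_cycle x (i + int n * int q)" for q
      proof (induction q)
        case (Suc q)
        then show ?case using onper[of "i + int n * int q"] by (simp add: algebra_simps)
      qed (simp add: \<open>\<not> on_cycle x i\<close>)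
      then have off_cycle: "\<not> on_cycle x (i + int n * \<bar>int k - i\<bar>)"
        by (metis int_nat_eq abs_ge_zero)
      have "\<bar>int k - i\<bar> \<le> int n * \<bar>int k - i\<bar>"
        using n(1) mult_right_mono[of 1 "int n" "\<bar>int k - i\<bar>"] by simp
      then obtain m where "i + int n * \<bar>int k - i\<bar> = int k + int m"
        using zle_iff_zadd[of "int k" "i + int n * \<bar>int k - i\<bar>"] by auto
      with off_cycle on[of m] show False by simp
    qed
    \<comment> \<open>Double counting: every window of 11 bits has 4 ones, and every bit lies in 11
      windows.\<close>
    have "(\<Sum>k<n. \<Sum>j<11. of_bool (x (int k - int j))) = 4 * int n"
      using on_cycle_window_sum[OF all all] by simp
    moreover have "(\<Sum>k<n. \<Sum>j<11. of_bool (x (int k - int j))) = 11 * c"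
      unfolding c by (subst sum.swap, subst sum_shift) (simp_all add: per)
    ultimately have "11 * c = 4 * int n" by simp
    then have "11 dvd 4 * int n" by (metis dvd_triv_left)
    then have "11 dvd int n" by presburger
    then have "11 dvd n" by presburger
    with n show ?thesis by simp
  qed
qed

section \<open>Identifying codes as bit sequences\<close>

lemma mem_closed_nbhd_circ:
  assumes "0 < n" "u \<in> circ_verts n" "c \<in> circ_verts n"
  shows "c \<in> closed_nbhd (circ_verts n) (circ_adj n) u \<longleftrightarrow>
    (\<exists>e\<in>{-3, -1, 0, 1, 3}. [c = u + e] (mod int n))"
proof -
  have "c = u \<longleftrightarrow> [c = u] (mod int n)"
    using assms by (auto simp: circ_verts_def cong_def)
  then show ?thesis
    using assms by (auto simp: closed_nbhd_def circ_adj_def)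
qed

lemma circ_code_dominates:
  assumes "0 < n" and C: "identifying_code (circ_verts n) (circ_adj n) C"
  shows "\<exists>e\<in>{-3, -1, 0, 1, 3}. (i + e) mod int n \<in> C"
proof -
  have V: "i mod int n \<in> circ_verts n" using assms(1) by (simp add: circ_verts_def)
  have sub: "C \<subseteq> circ_verts n"
    using C by (simp add: identifying_code_def is_code_def)
  obtain c where c: "c \<in> C" "c \<in> closed_nbhd (circ_verts n) (circ_adj n) (i mod int n)"
    using C V unfolding identifying_code_def I_set_def by blast
  then obtain e where e: "e \<in> {-3, -1, 0, 1, 3}" "[c = i mod int n + e] (mod int n)"
    using mem_closed_nbhd_circ[OF assms(1) V] sub by blast
  have "c mod int n = c" using c(1) sub by (auto simp: circ_verts_def)
  then have "(i + e) mod int n = c" using e(2) by (simp add: cong_def mod_simps)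
  with c e show ?thesis by blast
qed

lemma circ_code_separates:
  fixes d :: int
  assumes d: "0 < d" "d < int n" and C: "identifying_code (circ_verts n) (circ_adj n) C"
  defines "N \<equiv> {-3, -1, 0, 1, 3 :: int}"
  shows "\<exists>e\<in>(N - (+) d ` N) \<union> ((+) d ` N - N). (i + e) mod int n \<in> C"
proof -
  have n: "0 < n" using d by simp
  define u v where "u = i mod int n" and "v = (i + d) mod int n"
  have V: "u \<in> circ_verts n" "v \<in> circ_verts n"
    using n by (simp_all add: circ_verts_def u_def v_def)
  have sub: "C \<subseteq> circ_verts n"
    using C by (simp add: identifying_code_def is_code_def)
  have "u \<noteq> v"
  proof
    assume "u = v"
    then have "[i + d = i + 0] (mod int n)" by (simp add: u_def v_def cong_def)
    then have "[d = 0] (mod int n)" by (simp only: cong_add_lcancel)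
    then show False using d by (simp add: cong_def)
  qed
  then have "I_set (circ_verts n) (circ_adj n) C u \<noteq> I_set (circ_verts n) (circ_adj n) C v"
    using C V by (simp add: identifying_code_def)
  then obtain c where c: "c \<in> C" and ne: "(c \<in> closed_nbhd (circ_verts n) (circ_adj n) u) \<noteq>
      (c \<in> closed_nbhd (circ_verts n) (circ_adj n) v)"
    unfolding I_set_def by blast
  have cV: "c \<in> circ_verts n" using c sub by blast
  have cm: "c mod int n = c" using cV by (auto simp: circ_verts_def)
  have iff: "[c = u + e] (mod int n) \<longleftrightarrow> (i + e) mod int n = c"
      "[c = v + e] (mod int n) \<longleftrightarrow> (i + (d + e)) mod int n = c" for e
    using cm by (auto simp: cong_def u_def v_def mod_simps add.assoc)
  have "(\<exists>e\<in>N. (i + e) mod int n = c) \<noteq> (\<exists>e\<in>(+) d ` N. (i + e) mod int n = c)"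
    using ne unfolding mem_closed_nbhd_circ[OF n V(1) cV] mem_closed_nbhd_circ[OF n V(2) cV]
      iff N_def[symmetric] by blast
  with c show ?thesis by blast
qed

lemma circ_code_hits_patterns:
  assumes n: "6 < n" and C: "identifying_code (circ_verts n) (circ_adj n) C"
  shows "hits_patterns (\<lambda>i. i mod int n \<in> C)"
proof -
  have n0: "0 < n" using n by simp
  have sep: "\<exists>e\<in>({-3, -1, 0, 1, 3} - (+) d ` {-3, -1, 0, 1, 3}) \<union>
      ((+) d ` {-3, -1, 0, 1, 3} - {-3, -1, 0, 1, 3}). (i + e) mod int n \<in> C"
    if "0 < d" "d \<le> 6" for i d
    using circ_code_separates[OF that(1) _ C] that(2) n by simp
  note simps = insert_Diff_if add.commute
  \<comment> \<open>The shift by 3 moves the least offset -3 to 0, where the patterns start.\<close>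
  have "\<forall>p\<in>set patterns. \<exists>j\<in>set p. (i + int j) mod int n \<in> C" for i
    using circ_code_dominates[OF n0 C, of "i + 3"] sep[of 1 "i + 3"] sep[of 2 "i + 3"]
      sep[of 3 "i + 3"] sep[of 4 "i + 3"] sep[of 6 "i + 3"]
    by (simp add: patterns_def simps) argo
  then show ?thesis by (simp add: hits_patterns_def)
qed

text \<open>Ensures that the minimum in \<open>gamma_ID\<close> is attained: no two vertices have
  equal closed neighbourhoods.\<close>

lemma circ_has_identifying_code:
  assumes n: "9 < n"
  shows "identifying_code (circ_verts n) (circ_adj n) (circ_verts n)"
proof -
  have n0: "0 < n" using n by simp
  let ?B = "closed_nbhd (circ_verts n) (circ_adj n)"
  have I: "I_set (circ_verts n) (circ_adj n) (circ_verts n) u = ?B u" for u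
    by (auto simp: I_set_def closed_nbhd_def)
  have V: "0 \<in> circ_verts n" using n0 by (simp add: circ_verts_def)
  have self: "u \<in> ?B u" if "u \<in> circ_verts n" for u
    using that by (simp add: closed_nbhd_def)
  have "?B u \<noteq> ?B v" if u: "u \<in> circ_verts n" and v: "v \<in> circ_verts n" and "u \<noteq> v" for u v
  proof
    assume eq: "?B u = ?B v"
    have "u \<in> ?B v" using self[OF u] eq by simp
    then obtain d where d: "d \<in> {-3, -1, 0, 1, 3}" "[u = v + d] (mod int n)"
      unfolding mem_closed_nbhd_circ[OF n0 v u] by blast
    have "d \<noteq> 0"
      using d(2) u v \<open>u \<noteq> v\<close> by (auto simp: circ_verts_def cong_def)
    \<comment> \<open>Going 3 further in the direction of \<open>d\<close> gives a neighbour of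
      \<open>u\<close> at offset 4 or 6, up to sign, from \<open>v\<close>. It differs from each
      \<open>f\<close> by at most 9 < \<open>n\<close>.\<close>
    define e :: int where "e = (if 0 < d then 3 else -3)"
    define c where "c = (u + e) mod int n"
    have c: "c \<in> circ_verts n" using n0 by (simp add: c_def circ_verts_def)
    have "c \<in> ?B u"
      unfolding mem_closed_nbhd_circ[OF n0 u c] by (rule bexI[of _ e]) (auto simp: e_def c_def cong_def)
    then have "c \<in> ?B v" using eq by simp
    then obtain f where f: "f \<in> {-3, -1, 0, 1, 3}" "[c = v + f] (mod int n)"
      unfolding mem_closed_nbhd_circ[OF n0 v c] by blast
    have "[v + (d + e) = u + e] (mod int n)"
      using cong_sym[OF cong_add[OF d(2) cong_refl[of e]]] by (simp only: add.assoc)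
    also have "[u + e = c] (mod int n)" by (simp add: c_def cong_def)
    also note f(2)
    finally have "[d + e = f] (mod int n)" by (simp only: cong_add_lcancel)
    then have "int n dvd d + e - f" by (simp add: cong_iff_dvd_diff)
    moreover have "\<bar>d + e - f\<bar> < int n" using d(1) f(1) n by (auto simp: e_def)
    ultimately have "d + e - f = 0" using dvd_imp_le_int[of "d + e - f" "int n"] by linarith
    then show False using d(1) f(1) \<open>d \<noteq> 0\<close> by (auto simp: e_def)
  qed
  then show ?thesis
    using self n0 unfolding identifying_code_def is_code_def I
    by (metis V empty_iff subset_refl)
qed

section \<open>Cardinality and the three residue classes\<close>

lemma card_circ_code:
  assumes "C \<subseteq> circ_verts n"
  shows "(\<Sum>k<n. of_bool (int k mod int n \<in> C)) = int (card C)"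
proof -
  have "C = int ` {k \<in> {..<n}. int k \<in> C}"
  proof (intro equalityI subsetI)
    fix c assume "c \<in> C"
    with assms have "c \<in> circ_verts n" by blast
    then have "c = int (nat c)" "nat c < n" by (auto simp: circ_verts_def nat_less_iff)
    with \<open>c \<in> C\<close> show "c \<in> int ` {k \<in> {..<n}. int k \<in> C}"
      by (intro image_eqI[of _ _ "nat c"]) auto
  qed auto
  then have "card C = card (int ` {k \<in> {..<n}. int k \<in> C})"
    by simp
  also have "\<dots> = card {k \<in> {..<n}. int k \<in> C}"
    by (rule card_image) simp
  finally have "card C = card {k \<in> {..<n}. int k \<in> C}" .
  moreover have "(\<Sum>k<n. of_bool (int k mod int n \<in> C)) = (\<Sum>k<n. if int k \<in> C then 1 else 0 :: int)"
    by (intro sum.cong) auto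
  ultimately show ?thesis by (simp add: sum.If_cases Int_def)
qed

lemma circ_code_density:
  assumes n: "6 < n" "\<not> 11 dvd n" and C: "identifying_code (circ_verts n) (circ_adj n) C"
  shows "4 \<le> 11 * int (card C) - 4 * int n \<or> int n \<le> 18 * (11 * int (card C) - 4 * int n)"
proof (rule periodic_density[OF circ_code_hits_patterns[OF n(1) C]])
  show "int (card C) = (\<Sum>k<n. of_bool (int k mod int n \<in> C))"
    using C card_circ_code by (simp add: identifying_code_def is_code_def)
qed (use n in auto)

theorem theorem5:
  fixes n :: nat
  assumes "n > 0"
    and "(\<exists>q1::nat. n = 11 * q1 + 2 \<and> q1 \<ge> 5)
       \<or> (\<exists>q2::nat. n = 11 * q2 + 5 \<and> q2 \<ge> 3)
       \<or> (\<exists>q3::nat. n = 11 * q3 + 8 \<and> q3 \<ge> 1)"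
  shows "int (gamma_ID (circ_verts n) (circ_adj n)) \<ge> \<lceil>4 * real n / 11\<rceil> + 1"
proof -
  have n: "9 < n" "\<not> 11 dvd n"
    using assms(2) by presburger+
  have "\<exists>k C. identifying_code (circ_verts n) (circ_adj n) C \<and> card C = k"
    using circ_has_identifying_code[OF n(1)] by blast
  from LeastI_ex[OF this] obtain C where C: "identifying_code (circ_verts n) (circ_adj n) C"
    and card: "card C = gamma_ID (circ_verts n) (circ_adj n)"
    unfolding gamma_ID_def by blast
  have density: "4 \<le> 11 * int (card C) - 4 * int n \<or> int n \<le> 18 * (11 * int (card C) - 4 * int n)"
    using circ_code_density[OF _ n(2) C] n(1) by simp
  \<comment> \<open>In the three cases a smaller code makes \<open>11 * card C - 4 * n\<close> at
    most 3, 2, 1, so \<open>density\<close> forces \<open>n\<close> to be at most 54, 36, 18,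
    against 57, 38, 19.\<close>
  from assms(2) have "4 * int n \<le> 11 * (int (card C) - 1)"
  proof (elim disjE exE conjE)
    fix q assume q: "n = 11 * q + 2" "5 \<le> q"
    have "4 * int q + 2 \<le> int (card C)"
    proof (rule ccontr)
      assume "\<not> 4 * int q + 2 \<le> int (card C)"
      with density q show False by auto
    qed
    with q show ?thesis by simp
  next
    fix q assume q: "n = 11 * q + 5" "3 \<le> q"
    have "4 * int q + 3 \<le> int (card C)"
    proof (rule ccontr)
      assume "\<not> 4 * int q + 3 \<le> int (card C)"
      with density q show False by auto
    qed
    with q show ?thesis by simp
  next
    fix q assume q: "n = 11 * q + 8" "1 \<le> q"
    have "4 * int q + 4 \<le> int (card C)"
    proof (rule ccontr)
      assume "\<not> 4 * int q + 4 \<le> int (card C)"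
      with density q show False by auto
    qed
    with q show ?thesis by simp
  qed
  then have "real_of_int (4 * int n) \<le> real_of_int (11 * (int (card C) - 1))"
    by (simp only: of_int_le_iff)
  then have "4 * real n / 11 \<le> real_of_int (int (card C) - 1)"
    by simp
  then have "\<lceil>4 * real n / 11\<rceil> \<le> int (card C) - 1"
    by (simp only: ceiling_le_iff)
  then show ?thesis
    unfolding card[symmetric] by simp
qed

end
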